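(* Let $E$ be a finite dimensional real Banach space, (compactly) embedded into another reflexive Banach space $Z$. Let $\Phi:E\to\mathbb{R}$ and $H:Z\to\mathbb{R}$ be Fréchet differentiable convex functionals with derivatives $\varphi:E\to E^{*}$ and $h:Z\to Z^{*}$ respectively, and suppose there exist constants $\alpha>1$, $\gamma>0$ such that $$\gamma\|v\|^{\alpha}\le\langle\varphi(v),v\rangle_{E^{*},E}\quad\text{for all }v\in E.$$ For $\lambda>0$ let $J:E\to\mathbb{R}$, $J(x)=\Phi(x)-\lambda H(x)$. Take any $\rho>0$. (i) There exists $\lambda^{*}>0$ such that for each $\lambda\in(0,\lambda^{*}]$ there exists $u\in B_{\rho}$ with $$J(u)=\inf_{x\in B_{\rho}}J(x)$$ and such that $u$ is a critical point of $J$, and thus it solves $\varphi(u)=\lambda h(u)$. If for some $v\in B_{\rho}$ it holds that $J(v)<0$, and $J(0)=0$, then $u$ is non-trivial (i.e. $u\neq0$). (ii) Assume additionally that for all $\lambda\in(0,\lambda^{*}]$ (with $u$ the corresponding point from (i)): (a) $J$ is anti-coercive; (b) $J(u)<\inf_{x\in\partial B_{\rho_{1}}}J(x)$ for some $\rho_{1}\ge\rho$. Then for any $\lambda\in(0,\lambda^{*}]$ the functional $J$ has at least three critical points, namely $u$ and two other critical points, one being a Mountain Pass point and the other an argument of a maximum of $J$ over $E$.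
   Context: $B_{\rho}\subset E$ denotes the closed ball centered at $0$ in $E$ with radius $\rho$, and $\partial B_{\rho}$ its boundary sphere. Elements of $E$ are regarded as elements of $Z$ via the embedding $E\subset Z$, and $h(u)\in Z^{*}$ is regarded as an element of $E^{*}$ by restriction, so that $\varphi(u)=\lambda h(u)$ means $\langle\varphi(u),x\rangle_{E^{*},E}=\lambda\langle h(u),x\rangle_{Z^{*},Z}$ for all $x\in E$. A critical point of $J$ is a point at which the derivative of $J$ on $E$ vanishes. $J$ is anti-coercive if $J(x)\to-\infty$ as $\|x\|\to+\infty$. A Mountain Pass point is a critical point $z$ of $J$ at a mountain pass level, i.e. $J(z)=\inf_{g\in\Gamma}\max_{s\in[0,1]}J(g(s))$, where $\Gamma$ is the family of continuous paths $g:[0,1]\to E$ joining two points $x_{0},x_{1}\in E$ that lie in distinct connected components of $E\setminus S$ for some closed set $S\subset E$, with $\inf_{x\in S}J(x)\ge b$ and $\max\{J(x_{0}),J(x_{1})\}<b$ for some real $b$.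
   Formalization: In part (ii) the space E is assumed to be non-zero: for E = {0} conditions (a) and (b) hold trivially (the sphere is empty, with infimum +∞), but E has only one point, so there cannot be three critical points. *)

theory Defs
  imports "HOL-Analysis.Analysis"
begin

definition finite_dimensional :: "'a::real_vector itself \<Rightarrow> bool" where
  "finite_dimensional _ \<longleftrightarrow> (\<exists>B::'a set. finite B \<and> span B = UNIV)"

(* The canonical map into the bidual is surjective (it is always isometric). *)
definition reflexive_space :: "'a::real_normed_vector itself \<Rightarrow> bool" where
  "reflexive_space _ \<longleftrightarrow>
     (\<forall>F :: ('a \<Rightarrow>\<^sub>L real) \<Rightarrow>\<^sub>L real. \<exists>z::'a. \<forall>f. blinfun_apply F f = blinfun_apply f z)"

(* Continuity and linearity are part of the type; the norm need not be preserved. *)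
definition compact_embedding ::
    "('a::real_normed_vector \<Rightarrow>\<^sub>L 'b::real_normed_vector) \<Rightarrow> bool" where
  "compact_embedding i \<longleftrightarrow>
     inj (blinfun_apply i) \<and> (\<forall>A. bounded A \<longrightarrow> compact (closure (blinfun_apply i ` A)))"

definition critical_point :: "('a::real_normed_vector \<Rightarrow> real) \<Rightarrow> 'a \<Rightarrow> bool" where
  "critical_point J x \<longleftrightarrow> (J has_derivative (\<lambda>_. 0)) (at x)"

definition anti_coercive :: "('a::real_normed_vector \<Rightarrow> real) \<Rightarrow> bool" where
  "anti_coercive J \<longleftrightarrow> filterlim J at_bot at_infinity"

definition paths_between :: "'a::topological_space \<Rightarrow> 'a \<Rightarrow> (real \<Rightarrow> 'a) set" where
  "paths_between x0 x1 = {g. path g \<and> pathstart g = x0 \<and> pathfinish g = x1}"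

(* Infima and suprema of real functionals are taken in ereal throughout, because real Inf
   and Sup are unspecified on unbounded or empty sets.  For continuous J the supremum over
   the compact interval {0..1} is a maximum. *)
definition mountain_pass_point :: "('a::real_normed_vector \<Rightarrow> real) \<Rightarrow> 'a \<Rightarrow> bool" where
  "mountain_pass_point J z \<longleftrightarrow> critical_point J z \<and>
     (\<exists>x0 x1 S b. closed S \<and>
        (\<exists>C0\<in>components (- S). \<exists>C1\<in>components (- S). C0 \<noteq> C1 \<and> x0 \<in> C0 \<and> x1 \<in> C1) \<and>
        ereal b \<le> (INF x\<in>S. ereal (J x)) \<and>
        max (J x0) (J x1) < b \<and>
        ereal (J z) = (INF g\<in>paths_between x0 x1. SUP s\<in>{0..1}. ereal (J (g s))))"

definition critical_ball_minimizer ::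
    "('a::real_normed_vector \<Rightarrow> real) \<Rightarrow> real \<Rightarrow> 'a \<Rightarrow> bool" where
  "critical_ball_minimizer J \<rho> u \<longleftrightarrow>
     u \<in> cball 0 \<rho> \<and> ereal (J u) = (INF x\<in>cball 0 \<rho>. ereal (J x)) \<and> critical_point J u"

definition energy ::
    "('e::real_normed_vector \<Rightarrow>\<^sub>L 'z::real_normed_vector) \<Rightarrow> ('e \<Rightarrow> real) \<Rightarrow> ('z \<Rightarrow> real)
      \<Rightarrow> real \<Rightarrow> 'e \<Rightarrow> real" where
  "energy i \<Phi> H \<mu> x = \<Phi> x - \<mu> * H (blinfun_apply i x)"

end

theory Submission
  imports Defs
begin

text \<open>The gradient of \<open>J = \<Phi> - \<mu> H\<close> points outward on the sphere of radius \<open>\<rho>\<close> when \<open>\<mu>\<close> is small. Indeed, there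
the coercivity of \<open>\<phi>\<close> gives \<open>\<phi> x x \<ge> \<gamma> \<rho> powr \<alpha>\<close>, while the tangent inequality of the convex functional \<open>H\<close>
bounds the derivative of \<open>H\<close> at \<open>x\<close> in the direction \<open>x\<close> by \<open>H (2 x) - H x\<close>, which is bounded because closed
balls of a finite-dimensional space are compact. Hence a minimiser of \<open>J\<close> over the ball is not on the sphere
and is therefore a critical point (\<open>ball_minimizer_critical_point\<close>).

For the multiplicity result, anti-coercivity makes the sets \<open>J \<ge> a\<close> compact, so \<open>J\<close> has a maximiser \<open>w\<close>. Since
\<open>J\<close> on the sphere of radius \<open>\<rho>\<^sub>1\<close> exceeds \<open>J u\<close> by a positive amount, and \<open>J\<close> is again very negative far away, every
path from \<open>u\<close> to a distant point \<open>y\<close> climbs over that sphere, and the mountain pass level \<open>c\<close> is a critical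
level (\<open>mountain_pass_level_critical\<close>). The delicate point is that \<open>c\<close> may equal the maximum of \<open>J\<close>, so that the
critical point found could be \<open>w\<close> itself. This is met by the choice of \<open>y\<close>: of two opposite rays from \<open>u\<close> at most one
contains \<open>w\<close>, and \<open>y\<close> is taken on the other. If \<open>c\<close> is the maximum, the segment from \<open>u\<close> to \<open>y\<close> reaches the
level \<open>c\<close> at a point different from \<open>w\<close> (\<open>mountain_pass_point_besides_max\<close>). The argument is the same in
every positive dimension.

The critical level is found by deforming paths, which needs a continuous derivative of \<open>J\<close>. This comes from
convexity: differentiable convex functions have continuous directional derivatives
(\<open>convex_on_imp_continuous_derivative\<close>). The deformation is one explicit step along a continuous
descent direction, so no flow has to be integrated (\<open>noncritical_level_deformation\<close>).\<close>

section \<open>Compactness in finite-dimensional normed spaces\<close>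

text \<open>Induction on the spanning set. Adding a vector \<open>a\<close> outside \<open>span B\<close> keeps balls compact, because
\<open>a\<close> has positive distance from the closed subspace \<open>span B\<close>. This bounds both components of
\<open>k *\<^sub>R a + y\<close> by its norm and exhibits the new ball as a closed part of a continuous image of a compact product.\<close>
lemma compact_span_Int_cball:
  fixes B :: "'a::real_normed_vector set"
  assumes "finite B"
  shows "compact (span B \<inter> cball 0 r)"
  using assms
proof (induction B arbitrary: r)
  case empty
  have "finite (span {} \<inter> cball (0::'a) r)" by simp
  then show ?case by (rule finite_imp_compact)
next
  case (insert a B)
  have closed: "closed (span B)"
    unfolding closed_sequential_limits
  proof (intro allI impI, elim conjE)
    fix x l assume x: "\<forall>n. x n \<in> span B" and lim: "x \<longlonglongrightarrow> l"
    have "Bseq x" using lim by (intro convergent_imp_Bseq convergentI)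
    then obtain K where "\<And>n. norm (x n) \<le> K" by (metis BseqE)
    with x have "\<forall>n. x n \<in> span B \<inter> cball 0 K" by simp
    with lim insert.IH[of K] have "l \<in> span B \<inter> cball 0 K"
      by (meson closed_sequentially compact_imp_closed)
    then show "l \<in> span B" by simp
  qed
  show ?case
  proof (cases "a \<in> span B")
    case True
    then show ?thesis using insert.IH by (simp add: span_redundant)
  next
    case False
    define d where "d = infdist a (span B)"
    have "d > 0"
      unfolding d_def using False closed span_zero by (intro infdist_pos_not_in_closed) auto
    \<comment> \<open>The coefficient of \<open>a\<close> is controlled by the distance from \<open>a\<close> to the closed subspace.\<close>
    have coeff: "\<bar>k\<bar> * d \<le> norm (k *\<^sub>R a + y)" if "y \<in> span B" for k y
    proof (cases "k = 0")
      case False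
      have "d \<le> dist a (- (1/k) *\<^sub>R y)"
        unfolding d_def using that by (intro infdist_le span_scale)
      then have "\<bar>k\<bar> * d \<le> \<bar>k\<bar> * norm (a + (1/k) *\<^sub>R y)"
        by (intro mult_left_mono) (auto simp: dist_norm)
      also have "\<dots> = norm (k *\<^sub>R (a + (1/k) *\<^sub>R y))" by simp
      also have "\<dots> = norm (k *\<^sub>R a + y)" using False by (simp add: algebra_simps)
      finally show ?thesis .
    qed simp
    define K where "K = \<bar>r\<bar> / d"
    define R where "R = \<bar>r\<bar> + K * norm a"
    \<comment> \<open>So a vector of norm at most \<open>r\<close> has its \<open>a\<close>-coefficient in \<open>[-K, K]\<close> and its remaining part
      in the ball of radius \<open>R\<close> of \<open>span B\<close>.\<close>
    let ?I = "(\<lambda>p. fst p *\<^sub>R a + snd p) ` ({-K..K} \<times> (span B \<inter> cball 0 R))"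
    have "compact ?I"
      by (intro compact_continuous_image compact_Times insert.IH continuous_intros compact_Icc)
    moreover have "span (insert a B) \<inter> cball 0 r = ?I \<inter> cball 0 r"
    proof (intro equalityI subsetI)
      fix x assume x: "x \<in> span (insert a B) \<inter> cball 0 r"
      then obtain k where k: "x - k *\<^sub>R a \<in> span B" by (auto simp: span_breakdown_eq)
      have "\<bar>k\<bar> * d \<le> norm x" using coeff[OF k, of k] by simp
      then have "\<bar>k\<bar> * d \<le> \<bar>r\<bar>" using x by auto
      then have kK: "\<bar>k\<bar> \<le> K" using \<open>d > 0\<close> by (simp add: K_def pos_le_divide_eq)
      have "norm (x - k *\<^sub>R a) \<le> norm x + norm (k *\<^sub>R a)" by (rule norm_triangle_ineq4)
      also have "\<dots> \<le> R"
        using x kK by (auto simp: R_def intro!: add_mono mult_right_mono)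
      finally have "x - k *\<^sub>R a \<in> span B \<inter> cball 0 R" using k by simp
      moreover have "k \<in> {-K..K}" using kK by auto
      ultimately have "x \<in> ?I" by (intro image_eqI[of _ _ "(k, x - k *\<^sub>R a)"]) auto
      then show "x \<in> ?I \<inter> cball 0 r" using x by simp
    next
      fix x assume "x \<in> ?I \<inter> cball 0 r"
      then obtain k y where "x = k *\<^sub>R a + y" "y \<in> span B" "x \<in> cball 0 r" by auto
      then show "x \<in> span (insert a B) \<inter> cball 0 r"
        by (auto simp: span_breakdown_eq intro!: exI[of _ k])
    qed
    ultimately show ?thesis by (simp add: compact_Int_closed)
  qed
qed

corollary finite_dimensional_compact_iff:
  fixes S :: "'a::real_normed_vector set"
  assumes "finite_dimensional TYPE('a)"
  shows "compact S \<longleftrightarrow> bounded S \<and> closed S"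
proof
  assume S: "bounded S \<and> closed S"
  obtain B :: "'a set" where B: "finite B" "span B = UNIV"
    using assms by (auto simp: finite_dimensional_def)
  obtain r where "\<forall>x\<in>S. norm x \<le> r" using S by (auto simp: bounded_iff)
  then have "S = (span B \<inter> cball 0 r) \<inter> S" using B by auto
  then show "compact S"
    using compact_Int_closed[OF compact_span_Int_cball[OF B(1), of r]] S by metis
qed (simp add: compact_imp_bounded compact_imp_closed)

section \<open>Derivatives of convex functions\<close>

lemma has_derivative_along_line:
  fixes F :: "'a::real_normed_vector \<Rightarrow> real"
  assumes "(F has_derivative D) (at (x + t *\<^sub>R b))"
  shows "((\<lambda>t. F (x + t *\<^sub>R b)) has_real_derivative D b) (at t)"
proof -
  interpret D: bounded_linear D using assms by (rule has_derivative_bounded_linear)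
  have "((\<lambda>t. x + t *\<^sub>R b) has_derivative (\<lambda>t. t *\<^sub>R b)) (at t)"
    by (auto intro!: derivative_eq_intros)
  from has_derivative_compose[OF this assms] show ?thesis
    by (simp add: has_field_derivative_def D.scaleR mult.commute[of _ "D b"])
qed

text \<open>The tangent inequality. If it failed, \<open>F\<close> would rise above its chord from \<open>x\<close> to \<open>x + b\<close> just after \<open>x\<close>.\<close>
lemma convex_on_imp_above_derivative:
  fixes F :: "'a::real_normed_vector \<Rightarrow> real"
  assumes "convex_on UNIV F" and "(F has_derivative D) (at x)"
  shows "D b \<le> F (x + b) - F x"
proof (rule ccontr)
  assume neg: "\<not> ?thesis"
  define g where "g t = F (x + t *\<^sub>R b) - t * (F (x + b) - F x)" for t
  have "((\<lambda>t. F (x + t *\<^sub>R b)) has_real_derivative D b) (at 0)"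
    using assms(2) by (intro has_derivative_along_line) simp
  then have "(g has_real_derivative D b - (F (x + b) - F x)) (at 0)"
    unfolding g_def by (auto intro!: derivative_eq_intros)
  then obtain d where d: "d > 0" "\<And>t. 0 < t \<Longrightarrow> t < d \<Longrightarrow> g 0 < g t"
    using neg DERIV_pos_inc_right[of g "D b - (F (x + b) - F x)" 0] by auto
  define t where "t = min 1 (d / 2)"
  have t: "0 < t" "t < d" "t \<le> 1" using d(1) by (auto simp: t_def)
  have "F ((1 - t) *\<^sub>R x + t *\<^sub>R (x + b)) \<le> (1 - t) * F x + t * F (x + b)"
    using t by (intro convex_onD[OF assms(1)]) auto
  then have "g t \<le> g 0" by (simp add: g_def algebra_simps)
  then show False using d(2)[OF t(1,2)] by simp
qed

text \<open>Convexity turns differentiability into continuity of each directional derivative, because the derivative is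
dominated by difference quotients of fixed step, which depend continuously on the base point.\<close>
lemma convex_on_imp_continuous_derivative:
  fixes F :: "'a::real_normed_vector \<Rightarrow> real"
  assumes convex: "convex_on UNIV F" and deriv: "\<And>x. (F has_derivative D x) (at x)"
  shows "continuous_on UNIV (\<lambda>x. D x b)"
proof -
  have cont: "isCont F x" for x using deriv has_derivative_continuous by blast
  \<comment> \<open>If \<open>D x b < a\<close>, some difference quotient at \<open>x\<close> with a fixed step \<open>t\<close> is below \<open>a\<close>. By continuity
    of \<open>F\<close> the same holds at nearby points, and there the quotient bounds the derivative from above.\<close>
  have upper: "\<forall>\<^sub>F y in at x. D y b < a" if less: "D x b < a" for x b a
  proof -
    define g where "g t = F (x + t *\<^sub>R b) - t * a" for t
    have "((\<lambda>t. F (x + t *\<^sub>R b)) has_real_derivative D x b) (at 0)"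
      using deriv by (intro has_derivative_along_line) simp
    then have "(g has_real_derivative D x b - a) (at 0)"
      unfolding g_def by (auto intro!: derivative_eq_intros)
    then obtain d where d: "d > 0" "\<And>t. 0 < t \<Longrightarrow> t < d \<Longrightarrow> g t < g 0"
      using less DERIV_neg_dec_right[of g "D x b - a" 0] by auto
    define t where "t = d / 2"
    have t: "0 < t" "t < d" using d(1) by (auto simp: t_def)
    have "((\<lambda>y. F (y + t *\<^sub>R b) - F y) \<longlongrightarrow> F (x + t *\<^sub>R b) - F x) (at x)"
      using cont by (intro tendsto_diff isCont_tendsto_compose[of _ F] tendsto_intros)
    moreover have "F (x + t *\<^sub>R b) - F x < t * a"
      using d(2)[OF t] by (simp add: g_def)
    ultimately have "\<forall>\<^sub>F y in at x. F (y + t *\<^sub>R b) - F y < t * a"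
      by (rule order_tendstoD)
    then show ?thesis
    proof eventually_elim
      case (elim y)
      have "t * D y b = D y (t *\<^sub>R b)"
        using deriv[of y] by (simp add: has_derivative_bounded_linear linear_simps(5))
      also have "\<dots> \<le> F (y + t *\<^sub>R b) - F y"
        using convex deriv by (rule convex_on_imp_above_derivative)
      also have "\<dots> < t * a" by (rule elim)
      finally show ?case using t by simp
    qed
  qed
  have "((\<lambda>y. D y b) \<longlongrightarrow> D x b) (at x)" for x
  proof (rule order_tendstoI)
    \<comment> \<open>Lower bounds are upper bounds in the opposite direction.\<close>
    fix a assume "a < D x b"
    have neg: "D y (- b) = - D y b" for y
      using deriv[of y] by (simp add: has_derivative_bounded_linear linear_simps(4))
    show "\<forall>\<^sub>F y in at x. a < D y b"
      using upper[of x "- b" "- a"] \<open>a < D x b\<close> by (simp add: neg)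
  qed (rule upper)
  then show ?thesis by (simp add: continuous_on_def)
qed

section \<open>Minimisation over a ball\<close>

text \<open>A minimiser on the bounding sphere could be improved by moving towards the centre, against the outward derivative.
So it lies in the open ball, where Fermat's rule applies.\<close>
lemma ball_minimizer_critical_point:
  fixes J :: "'a::real_normed_vector \<Rightarrow> real"
  assumes fin: "finite_dimensional TYPE('a)" and "\<rho> > 0"
    and deriv: "\<And>x. (J has_derivative D x) (at x)"
    and outward: "\<And>x. norm x = \<rho> \<Longrightarrow> D x x > 0"
  shows "\<exists>u. critical_ball_minimizer J \<rho> u"
proof -
  have contJ: "continuous_on UNIV J"
    by (meson continuous_at_imp_continuous_on deriv has_derivative_continuous)
  have "compact (cball (0::'a) \<rho>)" by (simp add: finite_dimensional_compact_iff[OF fin])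
  moreover have "cball (0::'a) \<rho> \<noteq> {}" using \<open>\<rho> > 0\<close> by simp
  moreover have "continuous_on (cball 0 \<rho>) J" using contJ by (rule continuous_on_subset) simp
  ultimately obtain u where u: "u \<in> cball 0 \<rho>" "\<And>x. x \<in> cball 0 \<rho> \<Longrightarrow> J u \<le> J x"
    using continuous_attains_inf by metis
  have "norm u \<noteq> \<rho>"
  proof
    assume \<rho>: "norm u = \<rho>"
    have "((\<lambda>t. J (u + t *\<^sub>R u)) has_real_derivative D u u) (at 0)"
      using deriv by (intro has_derivative_along_line) simp
    from DERIV_pos_inc_left[OF this outward[OF \<rho>]]
    obtain d where d: "d > 0" "\<And>t. 0 < t \<Longrightarrow> t < d \<Longrightarrow> J (u + (0 - t) *\<^sub>R u) < J (u + 0 *\<^sub>R u)"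
      by blast
    define t where "t = min 1 (d / 2)"
    have t: "0 < t" "t < d" "t \<le> 1" using d(1) by (auto simp: t_def)
    have "u + (0 - t) *\<^sub>R u = (1 - t) *\<^sub>R u" by (simp add: algebra_simps)
    moreover have "norm ((1 - t) *\<^sub>R u) \<le> \<rho>"
      using t \<rho> \<open>\<rho> > 0\<close> by (simp add: mult_left_le_one_le)
    ultimately have "J u \<le> J (u + (0 - t) *\<^sub>R u)" using u(2)[of "(1 - t) *\<^sub>R u"] by simp
    then show False using d(2)[OF t(1,2)] by simp
  qed
  then have "u \<in> ball 0 \<rho>" using u(1) by simp
  then have "D u = (\<lambda>_. 0)"
    using deriv[of u] u(2) by (intro differential_zero_maxmin[of u "ball 0 \<rho>" J]) auto
  then have "critical_point J u" using deriv[of u] by (simp add: critical_point_def)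
  moreover have "ereal (J u) = (INF x\<in>cball 0 \<rho>. ereal (J x))"
    using u by (intro antisym INF_greatest INF_lower) auto
  ultimately show ?thesis using u(1) by (auto simp: critical_ball_minimizer_def)
qed

section \<open>Critical points at the mountain pass level\<close>

text \<open>The compactness principle behind both choices of constants in the deformation below: an implication between a closed and
an open condition on a compact set survives a small relaxation of its hypothesis.\<close>
lemma compact_positive_margin:
  fixes f g :: "'a::topological_space \<Rightarrow> real"
  assumes "compact K" "continuous_on K f" "continuous_on K g"
    and pos: "\<And>x. x \<in> K \<Longrightarrow> f x \<le> 0 \<Longrightarrow> g x > 0"
  obtains \<epsilon> where "\<epsilon> > 0" "\<And>x. x \<in> K \<Longrightarrow> f x \<le> \<epsilon> \<Longrightarrow> g x > 0"
proof -
  define C where "C = {x \<in> K. g x \<le> 0}"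
  have "compact C"
  proof -
    obtain A where A: "closed A" "A \<inter> K = g -` {..0} \<inter> K"
      using assms(3) unfolding continuous_on_closed_invariant by blast
    have "C = K \<inter> A" using A(2) by (auto simp: C_def)
    then show ?thesis using assms(1) A(1) by auto
  qed
  show thesis
  proof (cases "C = {}")
    case True
    then show ?thesis using that[of 1] by (force simp: C_def)
  next
    case False
    have "continuous_on C f" using assms(2) by (rule continuous_on_subset) (auto simp: C_def)
    then obtain p where p: "p \<in> C" "\<forall>y\<in>C. f p \<le> f y"
      using continuous_attains_inf[OF \<open>compact C\<close> False] by blast
    then have "f p > 0" using pos[of p] by (auto simp: C_def not_less[symmetric])
    moreover have "g x > 0" if "x \<in> K" "f x \<le> f p / 2" for x
    proof (rule ccontr)
      assume "\<not> g x > 0"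
      then have "x \<in> C" using that by (simp add: C_def)
      then show False using p(2) that(2) \<open>f p > 0\<close> by force
    qed
    ultimately show ?thesis using that[of "f p / 2"] by simp
  qed
qed

text \<open>Away from critical points the straight step \<open>x - s *\<^sub>R V x\<close> lowers \<open>J\<close> for all small \<open>s\<close>, and compactness of the
superlevel sets makes the admissible range of \<open>s\<close> uniform near the level \<open>c\<close>.\<close>
lemma noncritical_level_deformation:
  fixes J :: "'a::real_normed_vector \<Rightarrow> real" and B :: "'a set"
  assumes B: "finite B" "span B = UNIV"
    and deriv: "\<And>x. (J has_derivative D x) (at x)"
    and contD: "\<And>b. continuous_on UNIV (\<lambda>x. D x b)"
    and superlevel: "\<And>a. compact {x. a \<le> J x}"
    and noncritical: "\<And>x. J x = c \<Longrightarrow> \<not> critical_point J x"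
    and "a < c"
  obtains \<epsilon> \<eta> where "\<epsilon> > 0" "continuous_on UNIV \<eta>"
    "\<And>x. J x \<le> a \<Longrightarrow> \<eta> x = x" "\<And>x. J x \<le> c + \<epsilon> \<Longrightarrow> J (\<eta> x) < c"
proof -
  have contJ: "continuous_on UNIV J"
    by (meson continuous_at_imp_continuous_on deriv has_derivative_continuous)
  have linD: "bounded_linear (D x)" for x using deriv by (rule has_derivative_bounded_linear)
  \<comment> \<open>A continuous substitute for the gradient: \<open>D x (V x)\<close> is the sum of the squares \<open>(D x b)\<^sup>2\<close>, which
    vanishes only where \<open>D x\<close> does, because \<open>B\<close> spans the space.\<close>
  define V where "V x = (\<Sum>b\<in>B. D x b *\<^sub>R b)" for x
  have contV: "continuous_on UNIV V"
    unfolding V_def by (intro continuous_intros contD)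
  \<comment> \<open>The rate at which \<open>J\<close> decreases after moving for time \<open>s\<close> from \<open>x\<close> along the straight line
    with direction \<open>- V x\<close>.\<close>
  define q where "q s x = D (x - s *\<^sub>R V x) (V x)" for s x
  have q_eq: "q s x = (\<Sum>b\<in>B. D x b * D (x - s *\<^sub>R V x) b)" for s x
  proof -
    interpret D: bounded_linear "D (x - s *\<^sub>R V x)" by (rule linD)
    show ?thesis unfolding q_def by (subst (2) V_def) (simp add: D.sum D.scaleR)
  qed
  have contq: "continuous_on UNIV (\<lambda>p. q (fst p) (snd p))"
    unfolding q_eq
    by (intro continuous_intros continuous_on_compose2[OF contD] continuous_on_compose2[OF contV]) auto
  have q0: "q 0 x > 0" if "J x = c" for x
  proof -
    have "q 0 x = (\<Sum>b\<in>B. (D x b)\<^sup>2)" by (simp add: q_eq power2_eq_square)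
    moreover have "\<exists>b\<in>B. D x b \<noteq> 0"
    proof (rule ccontr)
      assume "\<not> ?thesis"
      then have "D x y = 0" for y
        using linear_eq_0_on_span[OF bounded_linear.linear[OF linD], of B x y] B(2) by auto
      then have "D x = (\<lambda>_. 0)" by auto
      then show False using noncritical[OF that] deriv[of x] by (simp add: critical_point_def)
    qed
    ultimately show ?thesis by (auto intro!: sum_pos2[OF B(1)])
  qed
  obtain e where e: "e > 0"
    and q_pos: "\<And>s x. 0 \<le> s \<Longrightarrow> s \<le> e \<Longrightarrow> \<bar>J x - c\<bar> \<le> e \<Longrightarrow> q s x > 0"
  proof -
    \<comment> \<open>The function \<open>?f\<close> vanishes on \<open>?K\<close> exactly at time zero on the level \<open>c\<close>, where \<open>q\<close> is
      positive by \<open>q0\<close>.\<close>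
    let ?K = "{0..1::real} \<times> {x. c - 1 \<le> J x}"
    let ?f = "\<lambda>p. fst p + \<bar>J (snd p) - c\<bar>"
    have "compact ?K" by (intro compact_Times superlevel compact_Icc)
    moreover have "continuous_on ?K ?f"
      by (intro continuous_intros continuous_on_compose2[OF contJ]) auto
    moreover have "continuous_on ?K (\<lambda>p. q (fst p) (snd p))"
      using contq by (rule continuous_on_subset) simp
    moreover have "q (fst p) (snd p) > 0" if "p \<in> ?K" "?f p \<le> 0" for p
    proof -
      have "fst p = 0" "J (snd p) = c" using that by auto
      then show ?thesis using q0 by simp
    qed
    ultimately obtain d where d: "d > 0" "\<And>p. p \<in> ?K \<Longrightarrow> ?f p \<le> d \<Longrightarrow> q (fst p) (snd p) > 0"
      using compact_positive_margin[of ?K ?f "\<lambda>p. q (fst p) (snd p)"] by blast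
    show thesis
    proof (rule that[of "min 1 (d / 2)"])
      fix s x assume s: "0 \<le> s" "s \<le> min 1 (d/2)" and x: "\<bar>J x - c\<bar> \<le> min 1 (d/2)"
      have "(s, x) \<in> ?K" using s x by auto
      moreover have "?f (s, x) \<le> d" using s x by auto
      ultimately show "q s x > 0" using d(2)[of "(s, x)"] by simp
    qed (use d in simp)
  qed
  have descent: "J (x - s *\<^sub>R V x) < J x" if "0 < s" "s \<le> e" "\<bar>J x - c\<bar> \<le> e" for s x
  proof -
    have "((\<lambda>t. J (x - t *\<^sub>R V x)) has_real_derivative - q t x) (at t)" for t
    proof -
      have "((\<lambda>t. J (x + t *\<^sub>R (- V x))) has_real_derivative D (x + t *\<^sub>R (- V x)) (- V x)) (at t)"
        by (intro has_derivative_along_line deriv)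
      then show ?thesis by (simp add: q_def linear_simps(4)[OF linD])
    qed
    moreover have "- q t x < 0" if "0 \<le> t" "t \<le> s" for t
      using q_pos[of t x] that \<open>s \<le> e\<close> \<open>\<bar>J x - c\<bar> \<le> e\<close> by simp
    ultimately have "J (x - s *\<^sub>R V x) < J (x - 0 *\<^sub>R V x)"
      by (intro DERIV_neg_imp_decreasing[OF \<open>0 < s\<close>]) blast
    then show ?thesis by simp
  qed
  \<comment> \<open>The step length is cut off continuously: it is zero below the level \<open>a'\<close>, positive above it and
    at most \<open>e\<close>, so that every nonzero step taken from a point of level between \<open>a'\<close> and \<open>c\<close> descends.\<close>
  define a' where "a' = max a (c - e)"
  define \<eta> where "\<eta> x = x - min e (max 0 (J x - a')) *\<^sub>R V x" for x
  have a': "a \<le> a'" "c - e \<le> a'" "a' < c" using \<open>a < c\<close> e by (auto simp: a'_def)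
  have cont\<eta>: "continuous_on UNIV \<eta>"
    unfolding \<eta>_def by (intro continuous_intros contJ contV)
  have fix\<eta>: "\<eta> x = x" if "J x \<le> a'" for x using that e by (simp add: \<eta>_def)
  have below: "J (\<eta> x) < c" if "J x \<le> c" for x
  proof (cases "J x \<le> a'")
    case True
    then show ?thesis using fix\<eta> a' by simp
  next
    case False
    then have "J (\<eta> x) < J x"
      unfolding \<eta>_def using that a' e by (intro descent) auto
    then show ?thesis using that by simp
  qed
  \<comment> \<open>The map \<open>\<eta>\<close> takes the set \<open>J \<le> c\<close> strictly below \<open>c\<close>; by compactness of \<open>J \<ge> c\<close> it does the
    same for a slightly higher level.\<close>
  obtain \<epsilon> where \<epsilon>: "\<epsilon> > 0" "\<And>x. c \<le> J x \<Longrightarrow> J x - c \<le> \<epsilon> \<Longrightarrow> c - J (\<eta> x) > 0"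
  proof -
    have K: "compact {x. c \<le> J x}" by (rule superlevel)
    have "continuous_on UNIV (\<lambda>x. J x - c)" by (intro continuous_intros contJ)
    then have 1: "continuous_on {x. c \<le> J x} (\<lambda>x. J x - c)"
      by (rule continuous_on_subset) simp
    have "continuous_on UNIV (\<lambda>x. J (\<eta> x))"
      using contJ cont\<eta> by (rule continuous_on_compose2) simp
    then have "continuous_on UNIV (\<lambda>x. c - J (\<eta> x))" by (intro continuous_intros)
    then have 2: "continuous_on {x. c \<le> J x} (\<lambda>x. c - J (\<eta> x))"
      by (rule continuous_on_subset) simp
    show thesis
      by (rule compact_positive_margin[OF K 1 2]) (use below that in auto)
  qed
  show thesis
  proof (rule that[OF \<epsilon>(1) cont\<eta>])
    show "\<eta> x = x" if "J x \<le> a" for x using fix\<eta> a' that by simp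
    show "J (\<eta> x) < c" if "J x \<le> c + \<epsilon>" for x
      using \<epsilon>(2)[of x] below[of x] that by linarith
  qed
qed

text \<open>The mountain pass theorem. The Palais--Smale condition is replaced by compactness of the superlevel sets.\<close>
lemma mountain_pass_level_critical:
  fixes J :: "'a::real_normed_vector \<Rightarrow> real" and B :: "'a set"
  assumes "finite B" "span B = UNIV"
    and deriv: "\<And>x. (J has_derivative D x) (at x)"
    and contD: "\<And>b. continuous_on UNIV (\<lambda>x. D x b)"
    and superlevel: "\<And>a. compact {x. a \<le> J x}"
    and level: "ereal c = (INF g\<in>paths_between x0 x1. SUP s\<in>{0..1}. ereal (J (g s)))"
    and ends: "max (J x0) (J x1) < c"
  shows "\<exists>z. critical_point J z \<and> J z = c"
proof (rule ccontr)
  assume "\<not> ?thesis"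
  then have "\<And>x. J x = c \<Longrightarrow> \<not> critical_point J x" by blast
  from noncritical_level_deformation[OF assms(1-5) this ends]
  obtain \<epsilon> \<eta> where \<epsilon>: "\<epsilon> > 0" and \<eta>: "continuous_on UNIV \<eta>"
    "\<And>x. J x \<le> max (J x0) (J x1) \<Longrightarrow> \<eta> x = x" "\<And>x. J x \<le> c + \<epsilon> \<Longrightarrow> J (\<eta> x) < c"
    by metis
  have contJ: "continuous_on UNIV J"
    by (meson continuous_at_imp_continuous_on deriv has_derivative_continuous)
  \<comment> \<open>Deforming a nearly optimal path yields a path that stays below the infimum \<open>c\<close>.\<close>
  have "(INF g\<in>paths_between x0 x1. SUP s\<in>{0..1}. ereal (J (g s))) < ereal (c + \<epsilon>)"
    using level \<epsilon> by (metis ereal_less_eq(3) less_add_same_cancel1 not_less)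
  then obtain g where g: "g \<in> paths_between x0 x1" "(SUP s\<in>{0..1}. ereal (J (g s))) < ereal (c + \<epsilon>)"
    by (auto simp: INF_less_iff)
  have gs: "J (g s) \<le> c + \<epsilon>" if "s \<in> {0..1}" for s
  proof -
    have "ereal (J (g s)) \<le> (SUP s\<in>{0..1}. ereal (J (g s)))" using that by (rule SUP_upper)
    then have "ereal (J (g s)) < ereal (c + \<epsilon>)" using g(2) by (rule le_less_trans)
    then show ?thesis by simp
  qed
  have path: "path (\<eta> \<circ> g)"
    using g(1) continuous_on_subset[OF \<eta>(1)]
    by (intro path_continuous_image) (auto simp: paths_between_def)
  have \<eta>g: "\<eta> \<circ> g \<in> paths_between x0 x1"
    using g(1) \<eta>(2)[of x0] \<eta>(2)[of x1] path
    by (auto simp: paths_between_def pathstart_def pathfinish_def)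
  have contJg: "continuous_on {0..1} (\<lambda>s. J ((\<eta> \<circ> g) s))"
    using path unfolding path_def by (intro continuous_on_compose2[OF contJ]) auto
  obtain t where t: "t \<in> {0..1}" "\<forall>s\<in>{0..1}. J ((\<eta> \<circ> g) s) \<le> J ((\<eta> \<circ> g) t)"
    using continuous_attains_sup[OF compact_Icc _ contJg] by auto
  have "ereal c \<le> (SUP s\<in>{0..1}. ereal (J ((\<eta> \<circ> g) s)))"
    unfolding level using \<eta>g by (rule INF_lower)
  also have "\<dots> \<le> ereal (J ((\<eta> \<circ> g) t))"
    using t(2) by (intro SUP_least) auto
  also have "\<dots> < ereal c" using \<eta>(3)[OF gs[OF t(1)]] by simp
  finally show False by simp
qed

section \<open>Anti-coercive functionals\<close>

lemma anti_coercive_compact_superlevel: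
  fixes J :: "'a::real_normed_vector \<Rightarrow> real"
  assumes fin: "finite_dimensional TYPE('a)" and "continuous_on UNIV J" and "anti_coercive J"
  shows "compact {x. a \<le> J x}"
proof -
  obtain R where R: "\<And>x. R \<le> norm x \<Longrightarrow> J x < a"
    using assms(3) unfolding anti_coercive_def filterlim_at_bot_dense eventually_at_infinity by blast
  have "norm x \<le> R" if "a \<le> J x" for x using R[of x] that by linarith
  then have "bounded {x. a \<le> J x}" unfolding bounded_iff by blast
  moreover have "closed {x. a \<le> J x}"
    using assms(2) by (intro closed_Collect_le continuous_intros) auto
  ultimately show ?thesis by (simp add: finite_dimensional_compact_iff[OF fin])
qed

lemma anti_coercive_attains_max:
  fixes J :: "'a::real_normed_vector \<Rightarrow> real"
  assumes "finite_dimensional TYPE('a)" and cont: "continuous_on UNIV J" and "anti_coercive J"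
  obtains w where "\<And>x. J x \<le> J w"
proof -
  have "compact {x. J 0 \<le> J x}" using assms by (rule anti_coercive_compact_superlevel)
  moreover have "{x. J 0 \<le> J x} \<noteq> {}" by blast
  moreover have "continuous_on {x. J 0 \<le> J x} J" using cont by (rule continuous_on_subset) simp
  ultimately obtain w where "J 0 \<le> J w" "\<forall>x\<in>{x. J 0 \<le> J x}. J x \<le> J w"
    using continuous_attains_sup by blast
  then have "J x \<le> J w" for x by (cases "J 0 \<le> J x") auto
  then show ?thesis by (rule that)
qed

lemma global_max_imp_critical_point:
  assumes "(J has_derivative D) (at w)" and "\<And>x. J x \<le> J w"
  shows "critical_point J w"
proof -
  have "D = (\<lambda>_. 0)" using assms by (intro has_derivative_local_max[of J D w]) auto
  then show ?thesis using assms(1) by (simp add: critical_point_def)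
qed

text \<open>Used for paths, which must cross the sphere, and for components, which show that the sphere separates inside from outside.\<close>
lemma connected_meets_sphere:
  fixes C :: "'a::real_normed_vector set"
  assumes "connected C" "x \<in> C" "y \<in> C" "norm x \<le> r" "r \<le> norm y"
  shows "\<exists>z\<in>C. norm z = r"
proof -
  have "connected (norm ` C)"
    using assms(1) by (intro connected_continuous_image continuous_intros)
  then have "r \<in> norm ` C"
    using connectedD_interval[of "norm ` C" "norm x" "norm y" r] assms by blast
  then show ?thesis by auto
qed

text \<open>A ray and its opposite meet only in their common origin \<open>u\<close>.\<close>
lemma ray_avoiding_point:
  fixes u w e :: "'a::real_vector"
  assumes "w \<noteq> u" "e \<noteq> 0"
  obtains v where "v = e \<or> v = - e" "\<And>t. t \<ge> 0 \<Longrightarrow> w \<noteq> u + t *\<^sub>R v"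
proof (cases "\<exists>t\<ge>0. w = u + t *\<^sub>R e")
  case False
  then show ?thesis using that[of e] by blast
next
  case True
  then obtain t where t: "t \<ge> 0" "w = u + t *\<^sub>R e" by blast
  have "w \<noteq> u + s *\<^sub>R (- e)" if "s \<ge> 0" for s
  proof
    assume "w = u + s *\<^sub>R (- e)"
    then have "(t + s) *\<^sub>R e = 0" using t(2) by (simp add: algebra_simps)
    then have "t + s = 0" using assms(2) by simp
    then have "t = 0" using t(1) that by simp
    then show False using t(2) assms(1) by simp
  qed
  then show ?thesis using that[of "- e"] by blast
qed

text \<open>The segment used as a test path is chosen to miss the maximiser \<open>w\<close>. This is what keeps the mountain pass
point different from \<open>w\<close> even when the mountain pass level is the maximum of \<open>J\<close>.\<close>
proposition mountain_pass_point_besides_max: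
  fixes J :: "'a::real_normed_vector \<Rightarrow> real"
  assumes fin: "finite_dimensional TYPE('a)"
    and deriv: "\<And>x. (J has_derivative D x) (at x)"
    and contD: "\<And>b. continuous_on UNIV (\<lambda>x. D x b)"
    and ac: "anti_coercive J"
    and "e \<noteq> (0::'a)" and "norm u \<le> r" and "r > 0"
    and sphere: "ereal (J u) < (INF x\<in>sphere 0 r. ereal (J x))"
  obtains z w where "z \<noteq> u" "w \<noteq> u" "z \<noteq> w" "mountain_pass_point J z"
    "critical_point J w" "\<And>x. J x \<le> J w"
proof -
  have contJ: "continuous_on UNIV J"
    by (meson continuous_at_imp_continuous_on deriv has_derivative_continuous)
  have superlevel: "compact {x. a \<le> J x}" for a
    using fin contJ ac by (rule anti_coercive_compact_superlevel)
  obtain w where w: "\<And>x. J x \<le> J w" using anti_coercive_attains_max[OF fin contJ ac] by blast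
  have crit_max: "critical_point J x" if "J x = J w" for x
    using deriv[of x] by (rule global_max_imp_critical_point) (simp add: that w)
  define S where "S = sphere (0::'a) r"
  have "S = {x. norm x = r}" by (auto simp: S_def)
  then have "closed S" by (simp add: closed_Collect_eq continuous_on_norm_id)
  moreover have "bounded S" unfolding bounded_iff by (auto simp: S_def)
  ultimately have "compact S" by (simp add: finite_dimensional_compact_iff[OF fin])
  have "(r / norm e) *\<^sub>R e \<in> S"
    using \<open>e \<noteq> 0\<close> \<open>r > 0\<close> by (simp add: S_def)
  then have "S \<noteq> {}" by blast
  then obtain p where p: "p \<in> S" "\<And>x. x \<in> S \<Longrightarrow> J p \<le> J x"
    using continuous_attains_inf[OF \<open>compact S\<close>, of J] contJ continuous_on_subset by (metis subset_UNIV)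
  define b where "b = J p"
  have b: "ereal b \<le> (INF x\<in>S. ereal (J x))"
    using p(2) by (auto simp: b_def intro: INF_greatest)
  have "(INF x\<in>S. ereal (J x)) \<le> ereal b" unfolding b_def using p(1) by (rule INF_lower)
  with sphere have "ereal (J u) < ereal b" unfolding S_def by (rule less_le_trans)
  then have Jub: "J u < b" by simp
  have "u \<notin> S" using Jub p(2)[of u] by (auto simp: b_def)
  then have ur: "norm u < r" using \<open>norm u \<le> r\<close> by (simp add: S_def)
  have "w \<noteq> u" using Jub w[of p] by (auto simp: b_def)
  \<comment> \<open>Leave \<open>u\<close> in a direction that misses the maximiser \<open>w\<close>, and stop beyond the sphere.\<close>
  obtain v where v: "v = e \<or> v = - e" "\<And>t. t \<ge> 0 \<Longrightarrow> w \<noteq> u + t *\<^sub>R v"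
    using ray_avoiding_point[OF \<open>w \<noteq> u\<close> \<open>e \<noteq> 0\<close>] by blast
  have "v \<noteq> 0" using v(1) \<open>e \<noteq> 0\<close> by auto
  obtain R where R: "\<And>x. R \<le> norm x \<Longrightarrow> J x < b"
    using ac unfolding anti_coercive_def filterlim_at_bot_dense eventually_at_infinity by blast
  define T where "T = (max R (r + 1) + norm u) / norm v"
  define y where "y = u + T *\<^sub>R v"
  have pos: "max R (r + 1) + norm u > 0"
    using \<open>r > 0\<close> by (simp add: add_pos_nonneg less_max_iff_disj)
  then have "T \<ge> 0" by (simp add: T_def)
  have "norm (T *\<^sub>R v) = max R (r + 1) + norm u"
    using \<open>v \<noteq> 0\<close> pos by (simp add: T_def)
  moreover have "norm (T *\<^sub>R v) \<le> norm y + norm u"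
    using norm_triangle_ineq4[of y u] by (simp add: y_def)
  ultimately have normy: "max R (r + 1) \<le> norm y" by simp
  then have Jyb: "J y < b" and ry: "r < norm y" using R[of y] by auto
  have seg: "w \<notin> closed_segment u y"
  proof
    assume "w \<in> closed_segment u y"
    then obtain s where s: "0 \<le> s" "s \<le> 1" "w = (1 - s) *\<^sub>R u + s *\<^sub>R y"
      by (auto simp: closed_segment_def)
    then have "w = u + (s * T) *\<^sub>R v" by (simp add: y_def algebra_simps)
    then show False using v(2)[of "s * T"] s \<open>T \<ge> 0\<close> by simp
  qed
  have cross: "\<exists>s\<in>{0..1}. b \<le> J (g s)" if "g \<in> paths_between u y" for g
  proof -
    have "connected (path_image g)" "u \<in> path_image g" "y \<in> path_image g"
      using that by (auto simp: paths_between_def)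
    from connected_meets_sphere[OF this, of r] obtain z where "z \<in> path_image g" "norm z = r"
      using ur ry by auto
    then show ?thesis using p(2) by (auto simp: path_image_def b_def S_def)
  qed
  define m where "m = (INF g\<in>paths_between u y. SUP s\<in>{0..1}. ereal (J (g s)))"
  have bm: "ereal b \<le> m"
    unfolding m_def
  proof (rule INF_greatest)
    fix g assume "g \<in> paths_between u y"
    then obtain s where "s \<in> {0..1}" "b \<le> J (g s)" using cross by blast
    then show "ereal b \<le> (SUP s\<in>{0..1}. ereal (J (g s)))" by (intro SUP_upper2[of s]) auto
  qed
  obtain q where q: "q \<in> closed_segment u y" "\<And>x. x \<in> closed_segment u y \<Longrightarrow> J x \<le> J q"
    using continuous_attains_sup[OF compact_segment, of u y J] contJ continuous_on_subset
    by (metis ends_in_segment(1) empty_iff subset_UNIV)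
  have mq: "m \<le> ereal (J q)"
  proof -
    have "linepath u y \<in> paths_between u y" by (simp add: paths_between_def)
    then have "m \<le> (SUP s\<in>{0..1}. ereal (J (linepath u y s)))"
      unfolding m_def by (rule INF_lower)
    also have "\<dots> \<le> ereal (J q)"
      by (intro SUP_least) (use q(2) linepath_in_path in auto)
    finally show ?thesis .
  qed
  obtain c where c: "m = ereal c" using bm mq by (cases m) auto
  have "b \<le> c" "c \<le> J q" using bm mq by (auto simp: c)
  have ends: "max (J u) (J y) < c" using Jub Jyb \<open>b \<le> c\<close> by simp
  \<comment> \<open>If the mountain pass level lies below the maximum, its critical point cannot be \<open>w\<close>. Otherwise the
    highest point \<open>q\<close> of the segment is a second maximiser, since the segment misses \<open>w\<close>.\<close>
  obtain z where z: "critical_point J z" "J z = c" "z \<noteq> w"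
  proof (cases "c < J w")
    case True
    obtain B :: "'a set" where "finite B" "span B = UNIV"
      using fin by (auto simp: finite_dimensional_def)
    from mountain_pass_level_critical[OF this deriv contD superlevel c[symmetric, unfolded m_def] ends]
    show ?thesis using that True by blast
  next
    case False
    then have "J q = c" "J q = J w" using \<open>c \<le> J q\<close> w[of q] by auto
    moreover have "q \<noteq> w" using q(1) seg by blast
    ultimately show ?thesis using that crit_max by blast
  qed
  have "mountain_pass_point J z"
    unfolding mountain_pass_point_def
  proof (intro conjI exI)
    let ?C = "connected_component_set (- S)"
    have "u \<in> - S" "y \<in> - S" using ur ry by (auto simp: S_def)
    moreover have "?C u \<noteq> ?C y"
    proof
      assume "?C u = ?C y"
      then have "y \<in> ?C u" using \<open>y \<in> - S\<close> connected_component_refl by fastforce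
      moreover have "u \<in> ?C u" using \<open>u \<in> - S\<close> connected_component_refl by fastforce
      ultimately obtain z where "z \<in> ?C u" "norm z = r"
        using connected_meets_sphere[of "?C u" u y r] ur ry by auto
      then show False using connected_component_subset[of "- S" u] by (auto simp: S_def)
    qed
    ultimately show "\<exists>C0\<in>components (- S). \<exists>C1\<in>components (- S). C0 \<noteq> C1 \<and> u \<in> C0 \<and> y \<in> C1"
      by (intro bexI[of _ "?C u"] bexI[of _ "?C y"]) (auto simp: components_def)
    show "max (J u) (J y) < b" using Jub Jyb by simp
    show "ereal (J z) = (INF g\<in>paths_between u y. SUP s\<in>{0..1}. ereal (J (g s)))"
      using z(2) c by (simp add: m_def)
  qed (use z b \<open>closed S\<close> in auto)
  moreover have "z \<noteq> u" using z(2) Jub \<open>b \<le> c\<close> by auto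
  ultimately show thesis using that[of z w] z \<open>w \<noteq> u\<close> crit_max[of w] w by blast
qed

section \<open>Differences of convex functionals\<close>

theorem theorem4:
  fixes i :: "'e::banach \<Rightarrow>\<^sub>L 'z::banach"
    and \<Phi> :: "'e \<Rightarrow> real" and H :: "'z \<Rightarrow> real"
    and \<phi> :: "'e \<Rightarrow> ('e \<Rightarrow>\<^sub>L real)" and h :: "'z \<Rightarrow> ('z \<Rightarrow>\<^sub>L real)"
    and \<alpha> \<gamma> \<rho> :: real
  assumes "finite_dimensional TYPE('e)"
    and "reflexive_space TYPE('z)"
    and "compact_embedding i"
    and "convex_on UNIV \<Phi>" and "\<And>x. (\<Phi> has_derivative blinfun_apply (\<phi> x)) (at x)"
    and "convex_on UNIV H" and "\<And>z. (H has_derivative blinfun_apply (h z)) (at z)"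
    and "\<alpha> > 1" and "\<gamma> > 0"
    and "\<And>v. \<gamma> * norm v powr \<alpha> \<le> blinfun_apply (\<phi> v) v"
    and "\<rho> > 0"
  shows
    "(\<exists>\<mu>s>0. \<forall>\<mu>\<in>{0<..\<mu>s}. \<exists>u.
        critical_ball_minimizer (energy i \<Phi> H \<mu>) \<rho> u \<and>
        (\<forall>x. blinfun_apply (\<phi> u) x = \<mu> * blinfun_apply (h (blinfun_apply i u)) (blinfun_apply i x)) \<and>
        ((\<exists>v\<in>cball 0 \<rho>. energy i \<Phi> H \<mu> v < 0) \<and> energy i \<Phi> H \<mu> 0 = 0 \<longrightarrow> u \<noteq> 0))
     \<and>
     (\<forall>\<mu>s>0. \<forall>u :: real \<Rightarrow> 'e.
        (\<exists>x::'e. x \<noteq> 0) \<and>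
        (\<forall>\<mu>\<in>{0<..\<mu>s}. critical_ball_minimizer (energy i \<Phi> H \<mu>) \<rho> (u \<mu>)) \<and>
        (\<forall>\<mu>\<in>{0<..\<mu>s}.
           anti_coercive (energy i \<Phi> H \<mu>) \<and>
           (\<exists>\<rho>1\<ge>\<rho>. ereal (energy i \<Phi> H \<mu> (u \<mu>))
                      < (INF x\<in>sphere 0 \<rho>1. ereal (energy i \<Phi> H \<mu> x))))
        \<longrightarrow>
        (\<forall>\<mu>\<in>{0<..\<mu>s}. \<exists>z w.
           z \<noteq> u \<mu> \<and> w \<noteq> u \<mu> \<and> z \<noteq> w \<and>
           critical_point (energy i \<Phi> H \<mu>) (u \<mu>) \<and>
           mountain_pass_point (energy i \<Phi> H \<mu>) z \<and>
           critical_point (energy i \<Phi> H \<mu>) w \<and>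
           (\<forall>x. energy i \<Phi> H \<mu> x \<le> energy i \<Phi> H \<mu> w)))"
proof -
  note fin = assms(1)
  define F where "F x = H (i x)" for x
  define DF where "DF x y = h (i x) (i y)" for x y
  have derivF: "(F has_derivative DF x) (at x)" for x
    unfolding F_def DF_def
    by (rule has_derivative_compose[OF _ assms(7)])
       (rule bounded_linear_imp_has_derivative[OF blinfun.bounded_linear_right])
  have convF: "convex_on UNIV F"
    unfolding F_def using convex_onD[OF assms(6)]
    by (intro convex_onI) (auto simp: blinfun.add_right blinfun.scaleR_right)
  let ?J = "energy i \<Phi> H"
  define D where "D \<mu> x y = \<phi> x y - \<mu> * DF x y" for \<mu> x y
  have derivJ: "(?J \<mu> has_derivative D \<mu> x) (at x)" for \<mu> x
  proof -
    have "((\<lambda>x. \<Phi> x - \<mu> * F x) has_derivative (\<lambda>y. \<phi> x y - \<mu> * DF x y)) (at x)"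
      by (intro has_derivative_diff has_derivative_mult_right assms(5) derivF)
    then show ?thesis by (simp add: energy_def[abs_def] F_def D_def[abs_def])
  qed
  have contD: "continuous_on UNIV (\<lambda>x. D \<mu> x b)" for \<mu> b
    unfolding D_def
    by (intro continuous_intros convex_on_imp_continuous_derivative[OF convF derivF]
        convex_on_imp_continuous_derivative[OF assms(4,5)])
  \<comment> \<open>The radius is \<open>2 * \<rho>\<close> because the tangent inequality compares \<open>F x\<close> with \<open>F (x + x)\<close>.\<close>
  obtain N where N: "N \<ge> 0" "\<And>x. norm x \<le> 2 * \<rho> \<Longrightarrow> \<bar>F x\<bar> \<le> N"
  proof -
    have "compact (cball (0::'e) (2 * \<rho>))" by (simp add: finite_dimensional_compact_iff[OF fin])
    moreover have "continuous_on (cball 0 (2 * \<rho>)) F"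
      by (meson continuous_at_imp_continuous_on derivF has_derivative_continuous)
    ultimately have "bounded (F ` cball 0 (2 * \<rho>))"
      by (intro compact_imp_bounded compact_continuous_image)
    then obtain N where "\<forall>x\<in>cball 0 (2 * \<rho>). \<bar>F x\<bar> \<le> N" by (auto simp: bounded_iff)
    then have N: "\<bar>F x\<bar> \<le> N" if "norm x \<le> 2 * \<rho>" for x using that by simp
    have "N \<ge> 0" using N[of 0] assms(11) by auto
    then show thesis using N that by blast
  qed
  \<comment> \<open>The estimate below bounds \<open>DF x x\<close> by \<open>2 * N\<close> on the sphere; the added \<open>1\<close> makes the inequality strict and
    keeps the denominator positive.\<close>
  define \<mu>s where "\<mu>s = \<gamma> * \<rho> powr \<alpha> / (2 * N + 1)"
  have "\<gamma> * \<rho> powr \<alpha> > 0" using assms(9,11) by simp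
  then have "\<mu>s > 0" using N(1) by (simp add: \<mu>s_def)
  have outward: "D \<mu> x x > 0" if "0 < \<mu>" "\<mu> \<le> \<mu>s" "norm x = \<rho>" for \<mu> x
  proof -
    have "DF x x \<le> F (x + x) - F x"
      by (rule convex_on_imp_above_derivative[OF convF derivF])
    also have "\<dots> \<le> 2 * N"
      using N(2)[of "x + x"] N(2)[of x] norm_triangle_ineq[of x x] that(3) assms(11) by auto
    finally have "\<mu> * DF x x \<le> \<mu>s * (2 * N)"
      using that N(1) by (intro order_trans[OF mult_left_mono mult_right_mono]) auto
    also have "\<dots> < \<mu>s * (2 * N + 1)" using \<open>\<mu>s > 0\<close> by simp
    also have "\<dots> = \<gamma> * norm x powr \<alpha>" using N(1) that(3) by (simp add: \<mu>s_def)
    also have "\<dots> \<le> \<phi> x x" by (rule assms(10))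
    finally show ?thesis by (simp add: D_def)
  qed
  have part1: "\<exists>u. critical_ball_minimizer (?J \<mu>) \<rho> u \<and>
      (\<forall>x. \<phi> u x = \<mu> * h (i u) (i x)) \<and>
      ((\<exists>v\<in>cball 0 \<rho>. ?J \<mu> v < 0) \<and> ?J \<mu> 0 = 0 \<longrightarrow> u \<noteq> 0)"
    if \<mu>: "\<mu> \<in> {0<..\<mu>s}" for \<mu>
  proof -
    obtain u where u: "critical_ball_minimizer (?J \<mu>) \<rho> u"
      using ball_minimizer_critical_point[OF fin assms(11) derivJ, of \<mu>] outward \<mu> by auto
    have "D \<mu> u = (\<lambda>_. 0)"
      using u derivJ[of \<mu> u]
      by (auto simp: critical_ball_minimizer_def critical_point_def intro: has_derivative_unique)
    then have "\<forall>x. \<phi> u x = \<mu> * h (i u) (i x)"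
      by (auto simp: D_def[abs_def] DF_def fun_eq_iff)
    moreover have "u \<noteq> 0" if v: "v \<in> cball 0 \<rho>" "?J \<mu> v < 0" and "?J \<mu> 0 = 0" for v
    proof
      assume "u = 0"
      have "ereal (?J \<mu> u) \<le> ereal (?J \<mu> v)"
        using u INF_lower[OF v(1), of "\<lambda>x. ereal (?J \<mu> x)"]
        by (simp add: critical_ball_minimizer_def)
      then show False using that \<open>u = 0\<close> by simp
    qed
    ultimately show ?thesis using u by blast
  qed
  have part2: "\<exists>z w. z \<noteq> u \<and> w \<noteq> u \<and> z \<noteq> w \<and> critical_point (?J \<mu>) u \<and>
      mountain_pass_point (?J \<mu>) z \<and> critical_point (?J \<mu>) w \<and> (\<forall>x. ?J \<mu> x \<le> ?J \<mu> w)"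
    if "e \<noteq> (0::'e)" "critical_ball_minimizer (?J \<mu>) \<rho> u" "anti_coercive (?J \<mu>)" "\<rho> \<le> \<rho>1"
      "ereal (?J \<mu> u) < (INF x\<in>sphere 0 \<rho>1. ereal (?J \<mu> x))" for e u \<mu> \<rho>1
  proof -
    have "norm u \<le> \<rho>1" "critical_point (?J \<mu>) u"
      using that(2,4) by (auto simp: critical_ball_minimizer_def)
    moreover have "\<rho>1 > 0" using that(4) assms(11) by simp
    ultimately show ?thesis
      using mountain_pass_point_besides_max[OF fin derivJ contD that(3,1) _ _ that(5)] by metis
  qed
  show ?thesis
  proof (intro conjI allI impI ballI; (elim conjE exE)?)
    show "\<exists>\<mu>s>0. \<forall>\<mu>\<in>{0<..\<mu>s}. \<exists>u.
        critical_ball_minimizer (?J \<mu>) \<rho> u \<and>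
        (\<forall>x. \<phi> u x = \<mu> * h (i u) (i x)) \<and>
        ((\<exists>v\<in>cball 0 \<rho>. ?J \<mu> v < 0) \<and> ?J \<mu> 0 = 0 \<longrightarrow> u \<noteq> 0)"
      using \<open>\<mu>s > 0\<close> part1 by blast
  next
    fix \<mu>s \<mu> :: real and u :: "real \<Rightarrow> 'e" and e :: 'e
    assume "\<mu> \<in> {0<..\<mu>s}" "e \<noteq> 0"
      and "\<forall>\<mu>\<in>{0<..\<mu>s}. critical_ball_minimizer (?J \<mu>) \<rho> (u \<mu>)"
      and "\<forall>\<mu>\<in>{0<..\<mu>s}. anti_coercive (?J \<mu>) \<and>
        (\<exists>\<rho>1\<ge>\<rho>. ereal (?J \<mu> (u \<mu>)) < (INF x\<in>sphere 0 \<rho>1. ereal (?J \<mu> x)))"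
    then show "\<exists>z w. z \<noteq> u \<mu> \<and> w \<noteq> u \<mu> \<and> z \<noteq> w \<and> critical_point (?J \<mu>) (u \<mu>) \<and>
        mountain_pass_point (?J \<mu>) z \<and> critical_point (?J \<mu>) w \<and> (\<forall>x. ?J \<mu> x \<le> ?J \<mu> w)"
      using part2 by meson
  qed
qed

end
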